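(* Let $k\geqslant1$, $t\geqslant1$, $1\leqslant n\leqslant t$, and let $a_0,a_1,\dots,a_t$ be independent variables. Then \[ \operatorname{Tr}\Bigl(\Bigl(\frac{\partial}{\partial a_0}K_t^{[k]}(a_0,\dots,a_t)\Bigr)\bigl(K_t^{[k]}(a_0,\dots,a_t)\bigr)^{n-1}\Bigr)=\operatorname{Tr}\Bigl(\Bigl(\frac{\partial}{\partial a_n}K_t^{[k]}(a_0,\dots,a_t)\Bigr)\bigl(K_t^{[k]}(a_0,\dots,a_t)\bigr)^{n-1}\Bigr). \]
   Context: $i^{\langle l\rangle}$ denotes $i$ repeated $l$ times; $G_t^{[k]}=\{(1^{\langle l_1\rangle},\dots,t^{\langle l_t\rangle}):0\le l_i\le k\}$. The matrix $K_t^{[k]}(a_0,\dots,a_t)$ is indexed by $G_t^{[k]}$: for $\overline\alpha=(1^{\langle l_1\rangle},\dots,t^{\langle l_t\rangle})$, entry $(\overline\alpha,\overline\beta)$ is $\prod_{i=1}^{t-1}\binom{l_i}{p_i}\cdot\binom{k}{v-\sum p_i}a_0^{v-\sum p_i}\prod_{i=1}^{t-1}a_i^{p_i}\cdot\sum_{d=0}^{\min(l_t,k-v)}(d+v)!\binom k{d+v}\binom{l_t}da_t^d$ if $\overline\beta=(1^{\langle k-v+\sum_{i=1}^{t-1}p_i\rangle},2^{\langle l_1-p_1\rangle},\dots,t^{\langle l_{t-1}-p_{t-1}\rangle})$ for integers $0\le p_i\le l_i$ ($1\le i\le t-1$) and $\sum_{i=1}^{t-1}p_i\le v\le k$; $0$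 otherwise. Derivatives of a matrix are taken entrywise; the entries are polynomials in $a_0,\dots,a_t$ with integer coefficients. *)

theory Defs
  imports Complex_Main "HOL-Library.Poly_Mapping" "HOL-Library.FuncSet"
begin

text \<open>
  A monomial is a finitely supported exponent vector and a polynomial a finitely supported map
  from monomials to coefficients; the ring operations are those of \<^theory>\<open>HOL-Library.Poly_Mapping\<close>.
\<close>

type_synonym int_mpoly = "(nat \<Rightarrow>\<^sub>0 nat) \<Rightarrow>\<^sub>0 int"

definition Var :: "nat \<Rightarrow> int_mpoly" where
  "Var i = Poly_Mapping.single (Poly_Mapping.single i 1) 1"

text \<open>
  The term of \<open>p\<close> at a monomial \<open>m\<close> not involving \<open>x\<^sub>i\<close> contributes \<open>0\<close>, so the truncated
  subtraction of exponents is harmless.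
\<close>

definition partial_deriv :: "nat \<Rightarrow> int_mpoly \<Rightarrow> int_mpoly" where
  "partial_deriv i p =
     (\<Sum>m\<in>Poly_Mapping.keys p.
        Poly_Mapping.single (m - Poly_Mapping.single i 1)
          (of_nat (Poly_Mapping.lookup m i) * Poly_Mapping.lookup p m))"

text \<open>
  A matrix over the index set \<open>S\<close> is a function of two indices, of which only the values on
  \<open>S \<times> S\<close> matter.
\<close>

definition mat_times :: "'i set \<Rightarrow> ('i \<Rightarrow> 'i \<Rightarrow> 'a) \<Rightarrow> ('i \<Rightarrow> 'i \<Rightarrow> 'a) \<Rightarrow> 'i \<Rightarrow> 'i \<Rightarrow> 'a::comm_ring_1" where
  "mat_times S A B = (\<lambda>x y. \<Sum>z\<in>S. A x z * B z y)"

definition mat_id :: "'i \<Rightarrow> 'i \<Rightarrow> 'a::comm_ring_1" where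
  "mat_id = (\<lambda>x y. if x = y then 1 else 0)"

primrec mat_power :: "'i set \<Rightarrow> ('i \<Rightarrow> 'i \<Rightarrow> 'a) \<Rightarrow> nat \<Rightarrow> 'i \<Rightarrow> 'i \<Rightarrow> 'a::comm_ring_1" where
  "mat_power S A 0 = mat_id"
| "mat_power S A (Suc n) = mat_times S A (mat_power S A n)"

definition mat_trace :: "'i set \<Rightarrow> ('i \<Rightarrow> 'i \<Rightarrow> 'a) \<Rightarrow> 'a::comm_ring_1" where
  "mat_trace S A = (\<Sum>x\<in>S. A x x)"

definition mat_deriv :: "nat \<Rightarrow> ('i \<Rightarrow> 'i \<Rightarrow> int_mpoly) \<Rightarrow> 'i \<Rightarrow> 'i \<Rightarrow> int_mpoly" where
  "mat_deriv i A = (\<lambda>x y. partial_deriv i (A x y))"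

definition rep_word :: "nat \<Rightarrow> (nat \<Rightarrow> nat) \<Rightarrow> nat list" where
  "rep_word t l = concat (map (\<lambda>i. replicate (l i) i) [1..<Suc t])"

definition G :: "nat \<Rightarrow> nat \<Rightarrow> nat list set" where
  "G t k = {rep_word t l | l. \<forall>i\<in>{1..t}. l i \<le> k}"

text \<open>
  Below, \<open>l i\<close> is the multiplicity of \<open>i\<close> in the row index. The constraints on \<open>(p, v)\<close>
  make all natural-number subtractions in \<open>K_col\<close> and \<open>K_val\<close> exact.
\<close>

definition K_data :: "nat \<Rightarrow> nat \<Rightarrow> (nat \<Rightarrow> nat) \<Rightarrow> ((nat \<Rightarrow> nat) \<times> nat) set" where
  "K_data t k l = (SIGMA p : (\<Pi>\<^sub>E i\<in>{1..<t}. {0..l i}). {(\<Sum>i=1..<t. p i)..k})"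

definition K_col :: "nat \<Rightarrow> nat \<Rightarrow> (nat \<Rightarrow> nat) \<Rightarrow> (nat \<Rightarrow> nat) \<Rightarrow> nat \<Rightarrow> nat list" where
  "K_col t k l p v =
     rep_word t (\<lambda>i. if i = 1 then k - v + (\<Sum>j=1..<t. p j) else l (i - 1) - p (i - 1))"

definition K_val ::
  "nat \<Rightarrow> nat \<Rightarrow> (nat \<Rightarrow> 'a) \<Rightarrow> (nat \<Rightarrow> nat) \<Rightarrow> (nat \<Rightarrow> nat) \<Rightarrow> nat \<Rightarrow> 'a::comm_ring_1" where
  "K_val t k a l p v =
     (\<Prod>i=1..<t. of_nat (l i choose p i))
     * of_nat (k choose (v - (\<Sum>i=1..<t. p i))) * a 0 ^ (v - (\<Sum>i=1..<t. p i))
     * (\<Prod>i=1..<t. a i ^ p i)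
     * (\<Sum>d=0..min (l t) (k - v).
          of_nat (fact (d + v) * (k choose (d + v)) * (l t choose d)) * a t ^ d)"

text \<open>
  A column index determines the data \<open>(p, v)\<close> that produce it (\<open>K_col_inj\<close> below), so the sum
  has at most one nonzero term; see \<open>K_entry\<close> and \<open>K_entry_zero\<close>.
\<close>

definition K :: "nat \<Rightarrow> nat \<Rightarrow> (nat \<Rightarrow> 'a) \<Rightarrow> nat list \<Rightarrow> nat list \<Rightarrow> 'a::comm_ring_1" where
  "K t k a \<alpha> \<beta> =
     (let l = count_list \<alpha> in
        \<Sum>(p, v) \<in> K_data t k l. if \<beta> = K_col t k l p v then K_val t k a l p v else 0)"

lemma count_list_replicate_eq: "count_list (replicate n x) y = (if x = y then n else 0)"
  by (induction n) auto

lemma count_list_rep_word: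
  assumes "i \<in> {1..t}"
  shows "count_list (rep_word t l) i = l i"
proof -
  have "count_list (concat (map (\<lambda>i. replicate (l i) i) xs)) i =
          (\<Sum>j\<leftarrow>xs. if j = i then l i else 0)" for xs
    by (induction xs) (auto simp: count_list_replicate_eq)
  moreover have "(\<Sum>j\<leftarrow>[1..<Suc t]. if j = i then l i else 0) = l i"
    using assms by (subst sum_list_distinct_conv_sum_set) (auto simp: sum.delta)
  ultimately show ?thesis
    by (simp add: rep_word_def)
qed

lemma rep_word_inj:
  assumes "rep_word t l = rep_word t l'" "i \<in> {1..t}"
  shows "l i = l' i"
  using assms count_list_rep_word by metis

lemma finite_K_data: "finite (K_data t k l)"
  unfolding K_data_def by (intro finite_SigmaI finite_PiE) auto

lemma K_col_inj:
  assumes t: "t \<ge> 1" and pv: "(p, v) \<in> K_data t k l" and qw: "(q, w) \<in> K_data t k l"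
    and eq: "K_col t k l p v = K_col t k l q w"
  shows "p = q \<and> v = w"
proof -
  have p: "p \<in> (\<Pi>\<^sub>E i\<in>{1..<t}. {0..l i})" "(\<Sum>i=1..<t. p i) \<le> v" "v \<le> k"
    and q: "q \<in> (\<Pi>\<^sub>E i\<in>{1..<t}. {0..l i})" "(\<Sum>i=1..<t. q i) \<le> w" "w \<le> k"
    using pv qw by (auto simp: K_data_def)
  note inj = rep_word_inj[OF eq[unfolded K_col_def]]
  have "p i = q i" if i: "i \<in> {1..<t}" for i
  proof -
    have "l i - p i = l i - q i"
      using inj[of "Suc i"] i by auto
    moreover have "p i \<le> l i" "q i \<le> l i"
      using p(1) q(1) i by (auto dest: PiE_mem)
    ultimately show ?thesis by linarith
  qed
  hence pq: "p = q"
    using p(1) q(1) by (intro PiE_ext) auto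
  have "k - v + (\<Sum>j=1..<t. p j) = k - w + (\<Sum>j=1..<t. q j)"
    using inj[of 1] t by auto
  with pq p(3) q(3) show ?thesis by auto
qed

lemma K_entry:
  assumes "t \<ge> 1" and pv: "(p, v) \<in> K_data t k (count_list \<alpha>)"
  shows "K t k a \<alpha> (K_col t k (count_list \<alpha>) p v) = K_val t k a (count_list \<alpha>) p v"
proof -
  let ?l = "count_list \<alpha>"
  have "K t k a \<alpha> (K_col t k ?l p v) =
          (\<Sum>x\<in>K_data t k ?l. if x = (p, v) then K_val t k a ?l p v else 0)"
    unfolding K_def Let_def using K_col_inj[OF assms(1) pv]
    by (intro sum.cong refl) (auto split: prod.splits)
  also have "\<dots> = K_val t k a ?l p v"
    using pv finite_K_data[of t k ?l] by (simp add: sum.delta')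
  finally show ?thesis .
qed

lemma K_entry_zero:
  assumes "\<And>p v. (p, v) \<in> K_data t k (count_list \<alpha>) \<Longrightarrow> \<beta> \<noteq> K_col t k (count_list \<alpha>) p v"
  shows "K t k a \<alpha> \<beta> = 0"
  unfolding K_def Let_def using assms by (intro sum.neutral) auto

end

theory Submission
  imports Defs
begin

text \<open>
  Identify the index \<open>(1\<^bsup>l\<^sub>1\<^esup>, \<dots>, t\<^bsup>l\<^sub>t\<^esup>)\<close> with the monomial \<open>x\<^sub>1\<^bsup>l\<^sub>1\<^esup> \<cdots> x\<^sub>t\<^bsup>l\<^sub>t\<^esup>\<close>. The rows of \<open>K\<close> are then the
  images of the monomials under the operator
  \<open>f \<mapsto> L ((x\<^sub>1 + a\<^sub>0 y)\<^sup>k f(x\<^sub>2 + a\<^sub>1 y, \<dots>, x\<^sub>t + a\<^sub>t\<^sub>-\<^sub>1 y, 1 + a\<^sub>t y))\<close>,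
  where \<open>L\<close> is the linear functional with \<open>L (y\<^sup>s) = s! (k choose s)\<close>. Let \<open>K'\<close> be the same operator with
  an additional factor \<open>y\<close> under \<open>L\<close>, and let \<open>D\<^sub>j\<close> (\<open>lower t j\<close>) be the matrix of differentiation by
  \<open>x\<^sub>j\<close>. The chain rule gives, as products of matrices (the reverse of composition),
  \<open>\<partial>K/\<partial>a\<^sub>0 = K' D\<^sub>1\<close>, \<open>\<partial>K/\<partial>a\<^sub>n = D\<^sub>n K'\<close> and \<open>D\<^sub>j K = K D\<^sub>j\<^sub>+\<^sub>1\<close> for \<open>j < t\<close>. Hence
  \<open>Tr (K' D\<^sub>1 K\<^bsup>n-1\<^esup>) = Tr (K' K\<^bsup>n-1\<^esup> D\<^sub>n) = Tr (D\<^sub>n K' K\<^bsup>n-1\<^esup>)\<close>.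
\<close>

subsection \<open>Partial derivatives\<close>

text \<open>Cancellation can shrink the keys of a sum, so additivity needs the defining sum over a
  common superset.\<close>

lemma partial_deriv_superset:
  assumes "finite S" "Poly_Mapping.keys p \<subseteq> S"
  shows "partial_deriv i p =
     (\<Sum>m\<in>S. Poly_Mapping.single (m - Poly_Mapping.single i 1)
          (of_nat (Poly_Mapping.lookup m i) * Poly_Mapping.lookup p m))"
  unfolding partial_deriv_def using assms
  by (intro sum.mono_neutral_left) (auto simp: in_keys_iff)

lemma partial_deriv_add: "partial_deriv i (p + q) = partial_deriv i p + partial_deriv i q"
proof -
  let ?S = "Poly_Mapping.keys p \<union> Poly_Mapping.keys q"
  have "Poly_Mapping.keys (p + q) \<subseteq> ?S"
    by (rule Poly_Mapping.keys_add)
  then show ?thesis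
    by (simp add: partial_deriv_superset[of ?S] sum.distrib[symmetric] lookup_add
        distrib_left single_add)
qed

lemma partial_deriv_sum: "partial_deriv i (\<Sum>x\<in>A. f x) = (\<Sum>x\<in>A. partial_deriv i (f x))"
  by (induction A rule: infinite_finite_induct)
     (simp_all add: partial_deriv_add partial_deriv_def[of _ 0])

lemma partial_deriv_single:
  "partial_deriv i (Poly_Mapping.single m c) =
     Poly_Mapping.single (m - Poly_Mapping.single i 1) (of_nat (Poly_Mapping.lookup m i) * c)"
  by (subst partial_deriv_superset[of "{m}"]) auto

lemma Var_power: "Var i ^ n = Poly_Mapping.single (Poly_Mapping.single i n) 1"
  by (induction n) (simp_all add: Var_def mult_single single_add[symmetric])

lemma prod_Var_power:
  "(\<Prod>i\<in>A. Var i ^ m i) = Poly_Mapping.single (\<Sum>i\<in>A. Poly_Mapping.single i (m i)) 1"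
  by (induction A rule: infinite_finite_induct) (simp_all add: Var_power mult_single)

lemma partial_deriv_monomial:
  assumes "finite A" "j \<in> A"
  shows "partial_deriv j (of_nat c * (\<Prod>i\<in>A. Var i ^ m i)) =
     of_nat (m j * c) * (\<Prod>i\<in>A. Var i ^ (m(j := m j - 1)) i)"
proof -
  have [simp]: "of_nat c * Poly_Mapping.single m 1 = (Poly_Mapping.single m (of_nat c) :: int_mpoly)"
    for c m
    by (metis mult_single add_0 mult.right_neutral single_of_nat)
  have lookup: "Poly_Mapping.lookup (\<Sum>i\<in>A. Poly_Mapping.single i (m i)) x =
      (if x \<in> A then m x else 0)" for m :: "nat \<Rightarrow> nat" and x
    using assms(1) by (simp add: lookup_sum lookup_single when_def sum.delta)
  have "(\<Sum>i\<in>A. Poly_Mapping.single i (m i)) - Poly_Mapping.single j 1 =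
      (\<Sum>i\<in>A. Poly_Mapping.single i ((m(j := m j - 1)) i))"
    by (rule poly_mapping_eqI)
       (use assms in \<open>auto simp: lookup lookup_minus lookup_single when_def simp del: fun_upd_apply,
         auto\<close>)
  then show ?thesis
    using assms by (simp add: prod_Var_power partial_deriv_single lookup of_nat_mult[symmetric]
        del: fun_upd_apply of_nat_mult)
qed

subsection \<open>The weights of the transfer matrix\<close>

text \<open>The coefficient of \<open>z_0^(m 0) ... z_t^(m t)\<close> in the product of the powers
  \<open>(z_i + a_i y)^(b i)\<close>, after \<open>y^s\<close> is replaced by \<open>F s\<close>. If
  \<open>m i > b i\<close>, the binomial is 0, so truncated exponents do no harm.\<close>

definition weight ::
  "nat \<Rightarrow> (nat \<Rightarrow> 'a) \<Rightarrow> (nat \<Rightarrow> nat) \<Rightarrow> (nat \<Rightarrow> nat) \<Rightarrow> (nat \<Rightarrow> nat) \<Rightarrow> 'a::comm_ring_1" where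
  "weight t a F b m =
     of_nat ((\<Prod>i\<le>t. b i choose m i) * F (\<Sum>i\<le>t. b i - m i)) * (\<Prod>i\<le>t. a i ^ (b i - m i))"

lemma weight_eq_0: "i \<le> t \<Longrightarrow> b i < m i \<Longrightarrow> weight t a F b m = 0"
proof -
  assume "i \<le> t" "b i < m i"
  then have "(\<Prod>i\<le>t. b i choose m i) = 0"
    by auto
  then show ?thesis
    unfolding weight_def by (simp only: mult_zero_left of_nat_0)
qed

text \<open>Compare coefficients in d/dz_j of \<open>(z_j + a_j y)^(b j)\<close>, computed by the
  power rule and term by term.\<close>

lemma weight_absorb:
  assumes "j \<le> t"
  shows "of_nat (b j) * weight t a F (b(j := b j - 1)) m =
         of_nat (Suc (m j)) * weight t a F b (m(j := Suc (m j)))"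
proof -
  have split: "(\<Prod>i\<le>t. f i) = f j * (\<Prod>i\<in>{..t}-{j}. f i)" for f :: "nat \<Rightarrow> nat"
    using assms by (intro prod.remove) auto
  have "b j * (b j - 1 choose m j) = Suc (m j) * (b j choose Suc (m j))"
    by (cases "b j") (simp_all add: Suc_times_binomial_eq mult.commute
        del: binomial_Suc_Suc mult_Suc mult_Suc_right)
  then have "b j * (\<Prod>i\<le>t. (b(j := b j - 1)) i choose m i) =
      Suc (m j) * (\<Prod>i\<le>t. b i choose (m(j := Suc (m j))) i)"
    unfolding split by (simp add: mult.assoc[symmetric] del: mult_Suc mult_Suc_right)
  moreover have "(b(j := b j - 1)) i - m i = b i - (m(j := Suc (m j))) i" for i
    by auto
  ultimately show ?thesis
    unfolding weight_def mult.assoc[symmetric] of_nat_mult[symmetric] by presburger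
qed

text \<open>On \<open>(z_j + a_j y)^(b j)\<close> the derivative by a_j is y times the derivative by
  z_j. The factor y shifts the argument of \<open>F\<close>; the derivative by z_j raises the index
  \<open>m j\<close>.\<close>

lemma partial_deriv_weight:
  assumes "j \<le> t"
  shows "partial_deriv j (weight t Var F b m) =
         of_nat (Suc (m j)) * weight t Var (\<lambda>s. F (Suc s)) b (m(j := Suc (m j)))"
proof -
  let ?m' = "m(j := Suc (m j))"
  have split: "(\<Prod>i\<le>t. f i) = f j * (\<Prod>i\<in>{..t}-{j}. f i)" for f :: "nat \<Rightarrow> nat"
    using assms by (intro prod.remove) auto
  have split': "(\<Sum>i\<le>t. f i) = f j + (\<Sum>i\<in>{..t}-{j}. f i)" for f :: "nat \<Rightarrow> nat"
    using assms by (intro sum.remove) auto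
  have "(b j - m j) * (b j choose m j) = Suc (m j) * (b j choose Suc (m j))"
    by (metis binomial_absorb_comp binomial_absorption mult.commute)
  then have coeff: "(b j - m j) * (\<Prod>i\<le>t. b i choose m i) =
      Suc (m j) * (\<Prod>i\<le>t. b i choose ?m' i)"
    unfolding split by (simp add: mult.assoc[symmetric] del: mult_Suc mult_Suc_right)
  have exps: "((\<lambda>i. b i - m i)(j := b j - m j - 1)) i = b i - ?m' i" for i
    by auto
  have "(b j - m j) * ((\<Prod>i\<le>t. b i choose m i) * F (\<Sum>i\<le>t. b i - m i)) =
      Suc (m j) * ((\<Prod>i\<le>t. b i choose ?m' i) * F (Suc (\<Sum>i\<le>t. b i - ?m' i)))"
  \<comment> \<open>Once \<open>m j\<close> reaches \<open>b j\<close>, truncation may make the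
    arguments of \<open>F\<close> disagree, but then both sides are 0.\<close>
  proof (cases "m j < b j")
    case True
    then have "(\<Sum>i\<le>t. b i - m i) = Suc (\<Sum>i\<le>t. b i - ?m' i)"
      unfolding split' by simp
    then show ?thesis
      using coeff by (simp only: mult.assoc[symmetric])
  next
    case False
    then have "(\<Prod>i\<le>t. b i choose ?m' i) = 0"
      unfolding split by simp
    with False show ?thesis by simp
  qed
  then show ?thesis
    unfolding weight_def using assms
    by (subst partial_deriv_monomial) (simp_all only: exps of_nat_mult mult.assoc finite_atMost atMost_iff)
qed

text \<open>
  Setting \<open>l\<^sub>0 = k\<close> and writing \<open>e = l\<^sub>t - d\<close> for the summation index of \<open>K_val\<close> puts the factors for
  \<open>a\<^sub>0\<close>, \<open>a\<^sub>t\<close> and the other \<open>a\<^sub>i\<close> on the same footing. Summands with \<open>e > l\<^sub>t\<close> vanish.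
\<close>

definition transfer ::
  "nat \<Rightarrow> nat \<Rightarrow> (nat \<Rightarrow> 'a) \<Rightarrow> (nat \<Rightarrow> nat) \<Rightarrow> (nat \<Rightarrow> nat) \<Rightarrow> (nat \<Rightarrow> nat) \<Rightarrow> 'a::comm_ring_1" where
  "transfer t k a F l l' =
     (\<Sum>e\<le>k. weight t a F (l(0 := k)) ((\<lambda>i. l' (Suc i))(t := e)))"

lemma transfer_cong:
  assumes "t \<ge> 1" "\<And>i. i \<in> {1..t} \<Longrightarrow> l i = q i" "\<And>i. i \<in> {1..t} \<Longrightarrow> l' i = q' i"
  shows "transfer t k a F l l' = transfer t k a F q q'"
proof -
  have "(l(0 := k)) i = (q(0 := k)) i"
    "((\<lambda>i. l' (Suc i))(t := e)) i = ((\<lambda>i. q' (Suc i))(t := e)) i" if "i \<le> t" for i e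
    using assms that by auto
  then show ?thesis
    unfolding transfer_def weight_def by (intro sum.cong refl arg_cong2[of _ _ _ _ times]
      arg_cong[of _ _ of_nat] arg_cong[of _ _ F] prod.cong arg_cong2[of _ _ _ _ power]) simp_all
qed

text \<open>The variable x_(i+1) occurs only in factor i, whose exponent bounds its degree. This
  disposes of columns raised beyond multiplicity k, which lie outside \<open>G t k\<close>.\<close>

lemma transfer_eq_0:
  assumes "i < t" "(l(0 := k)) i < l' (Suc i)"
  shows "transfer t k a F l l' = 0"
  unfolding transfer_def using assms by (intro sum.neutral ballI weight_eq_0[of i]) auto

text \<open>Row slot j and column slot j+1 belong to the same factor
  \<open>(x_(j+1) + a_j y)^(l j)\<close>. The bounds on j keep away from the fixed exponent k in
  slot 0 and the summed index e in slot t.\<close>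

lemma transfer_absorb:
  assumes "1 \<le> j" "j < t"
  shows "of_nat (l j) * transfer t k a F (l(j := l j - 1)) l' =
         of_nat (Suc (l' (Suc j))) * transfer t k a F l (l'(Suc j := Suc (l' (Suc j))))"
proof -
  have "of_nat (l j) * weight t a F ((l(j := l j - 1))(0 := k)) ((\<lambda>i. l' (Suc i))(t := e)) =
     of_nat (Suc (l' (Suc j))) *
       weight t a F (l(0 := k)) ((\<lambda>i. (l'(Suc j := Suc (l' (Suc j)))) (Suc i))(t := e))" for e
  proof -
    have "(\<lambda>i. (l'(Suc j := Suc (l' (Suc j)))) (Suc i))(t := e) =
        ((\<lambda>i. l' (Suc i))(t := e))(j := Suc (l' (Suc j)))"
      using assms by auto
    then show ?thesis
      using weight_absorb[of j t "l(0 := k)" a F "(\<lambda>i. l' (Suc i))(t := e)"] assms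
      by (simp add: fun_upd_twist)
  qed
  then show ?thesis
    unfolding transfer_def sum_distrib_left by simp
qed

lemma partial_deriv_0_transfer:
  assumes "t \<ge> 1"
  shows "partial_deriv 0 (transfer t k Var F l l') =
         of_nat (Suc (l' 1)) * transfer t k Var (\<lambda>s. F (Suc s)) l (l'(1 := Suc (l' 1)))"
proof -
  have "(\<lambda>i. (l'(1 := Suc (l' 1))) (Suc i))(t := e) =
      ((\<lambda>i. l' (Suc i))(t := e))(0 := Suc (l' 1))" for e
    using assms by auto
  then show ?thesis
    unfolding transfer_def partial_deriv_sum sum_distrib_left
    using assms by (simp add: partial_deriv_weight)
qed

text \<open>Expressing the derivative by lowering the row, not raising the column, also covers
  \<open>j = t\<close>, where the column slot is the summation index e.\<close>

lemma partial_deriv_transfer: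
  assumes "1 \<le> j" "j \<le> t"
  shows "partial_deriv j (transfer t k Var F l l') =
         of_nat (l j) * transfer t k Var (\<lambda>s. F (Suc s)) (l(j := l j - 1)) l'"
  unfolding transfer_def partial_deriv_sum sum_distrib_left
proof (intro sum.cong refl)
  fix e
  show "partial_deriv j (weight t Var F (l(0 := k)) ((\<lambda>i. l' (Suc i))(t := e))) =
     of_nat (l j) *
       weight t Var (\<lambda>s. F (Suc s)) ((l(j := l j - 1))(0 := k)) ((\<lambda>i. l' (Suc i))(t := e))"
    using weight_absorb[of j t "l(0 := k)" Var "\<lambda>s. F (Suc s)" "(\<lambda>i. l' (Suc i))(t := e)"] assms
    by (simp add: partial_deriv_weight fun_upd_twist)
qed

subsection \<open>Words as indices\<close>

lemma rep_word_cong: "(\<And>i. i \<in> {1..t} \<Longrightarrow> l i = l' i) \<Longrightarrow> rep_word t l = rep_word t l'"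
  unfolding rep_word_def by (intro arg_cong[of _ _ concat] map_cong refl) auto

lemma rep_word_eq_iff: "rep_word t l = rep_word t l' \<longleftrightarrow> (\<forall>i\<in>{1..t}. l i = l' i)"
  using rep_word_inj rep_word_cong by metis

lemma rep_word_in_G_iff: "rep_word t l \<in> G t k \<longleftrightarrow> (\<forall>i\<in>{1..t}. l i \<le> k)"
  unfolding G_def by (auto simp: rep_word_eq_iff)

lemma rep_word_count_list: "\<alpha> \<in> G t k \<Longrightarrow> rep_word t (count_list \<alpha>) = \<alpha>"
  unfolding G_def by (auto intro!: rep_word_cong simp: count_list_rep_word)

lemma count_list_le: "\<alpha> \<in> G t k \<Longrightarrow> i \<in> {1..t} \<Longrightarrow> count_list \<alpha> i \<le> k"
  unfolding G_def by (auto simp: count_list_rep_word)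

lemma rep_word_decrement_in_G:
  assumes "\<alpha> \<in> G t k"
  shows "rep_word t ((count_list \<alpha>)(j := count_list \<alpha> j - 1)) \<in> G t k"
  unfolding rep_word_in_G_iff
proof
  fix i assume "i \<in> {1..t}"
  then have "count_list \<alpha> i \<le> k"
    using assms by (rule count_list_le[rotated])
  then show "((count_list \<alpha>)(j := count_list \<alpha> j - 1)) i \<le> k"
    by auto
qed

lemma finite_G: "finite (G t k)"
proof -
  have "G t k \<subseteq> rep_word t ` (\<Pi>\<^sub>E i\<in>{1..t}. {..k})"
  proof
    fix \<alpha> assume "\<alpha> \<in> G t k"
    then have "\<alpha> = rep_word t (restrict (count_list \<alpha>) {1..t})"
      using rep_word_cong[of t "restrict (count_list \<alpha>) {1..t}" "count_list \<alpha>"]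
        rep_word_count_list by simp
    moreover have "restrict (count_list \<alpha>) {1..t} \<in> (\<Pi>\<^sub>E i\<in>{1..t}. {..k})"
      using \<open>\<alpha> \<in> G t k\<close> by (auto intro: count_list_le)
    ultimately show "\<alpha> \<in> rep_word t ` (\<Pi>\<^sub>E i\<in>{1..t}. {..k})" by blast
  qed
  then show ?thesis
    by (rule finite_subset) (intro finite_imageI finite_PiE, auto)
qed

lemma K_eq_transfer:
  assumes t: "t \<ge> 1" and \<alpha>: "\<alpha> \<in> G t k" and \<beta>: "\<beta> \<in> G t k"
  shows "K t k a \<alpha> \<beta> = transfer t k a (\<lambda>s. fact s * (k choose s)) (count_list \<alpha>) (count_list \<beta>)"
proof -
  let ?l = "count_list \<alpha>" and ?l' = "count_list \<beta>"
  let ?F = "\<lambda>s. fact s * (k choose s) :: nat"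
  \<comment> \<open>The only candidates: \<open>p\<close> solves
    \<open>l i - p i = l' (i+1)\<close>, and \<open>v\<close> solves
    \<open>k - v + P = l' 1\<close>.\<close>
  define p where "p = (\<lambda>i\<in>{1..<t}. ?l i - ?l' (Suc i))"
  define P where "P = (\<Sum>i=1..<t. p i)"
  define v where "v = k - ?l' 1 + P"
  have l'1: "?l' 1 \<le> k" and lt: "?l t \<le> k"
    using count_list_le \<alpha> \<beta> t by auto
  have atMost_t: "{..t} = insert 0 (insert t {1..<t})"
    using t by auto
  \<comment> \<open>Slots 0 and t are separated from the others; the total exponent of y is (k -
    l'_1) + P + (l_t - e) = v + (l_t - e).\<close>
  have split: "weight t a ?F (?l(0 := k)) ((\<lambda>i. ?l' (Suc i))(t := e)) =
      of_nat ((k choose ?l' 1) * ((?l t choose e) * (\<Prod>i=1..<t. ?l i choose ?l' (Suc i))) *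
        ?F (v + (?l t - e))) *
      (a 0 ^ (k - ?l' 1) * (a t ^ (?l t - e) * (\<Prod>i=1..<t. a i ^ p i)))" for e
    unfolding weight_def atMost_t using t by (simp add: p_def v_def P_def ac_simps)
  show ?thesis
  proof (cases "(\<forall>i\<in>{1..<t}. ?l' (Suc i) \<le> ?l i) \<and> v \<le> k")
    case True
    then have le: "\<And>i. i \<in> {1..<t} \<Longrightarrow> ?l' (Suc i) \<le> ?l i" and v: "v \<le> k"
      by auto
    have data: "(p, v) \<in> K_data t k ?l"
      using v by (auto simp: K_data_def p_def v_def P_def)
    have "K_col t k ?l p v = rep_word t ?l'"
      unfolding K_col_def
    proof (rule rep_word_cong)
      fix i assume "i \<in> {1..t}"
      then show "(if i = 1 then k - v + (\<Sum>j=1..<t. p j) else ?l (i - 1) - p (i - 1)) = ?l' i"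
        using le[of "i - 1"] v l'1 unfolding P_def[symmetric]
        by (auto simp: p_def v_def)
    qed
    then have "\<beta> = K_col t k ?l p v"
      using rep_word_count_list[OF \<beta>] by simp
    then have "K t k a \<alpha> \<beta> = K_val t k a ?l p v"
      using K_entry[OF t data] by simp
    also have "\<dots> = (\<Sum>d\<le>?l t. of_nat (?F (v + d) * (?l t choose d)) * a t ^ d) *
        (of_nat ((k choose ?l' 1) * (\<Prod>i=1..<t. ?l i choose ?l' (Suc i))) *
          (a 0 ^ (k - ?l' 1) * (\<Prod>i=1..<t. a i ^ p i)))"
    proof -
      have "(\<Sum>d=0..min (?l t) (k - v). of_nat (fact (d + v) * (k choose (d + v)) * (?l t choose d)) * a t ^ d)
        = (\<Sum>d\<le>?l t. of_nat (?F (v + d) * (?l t choose d)) * a t ^ d)"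
        using v by (intro sum.mono_neutral_cong_left) (auto simp: add.commute binomial_eq_0)
      moreover have "(\<Prod>i=1..<t. of_nat (?l i choose p i) :: 'a) =
          of_nat (\<Prod>i=1..<t. ?l i choose ?l' (Suc i))"
        unfolding of_nat_prod using le
        by (intro prod.cong refl) (auto simp: p_def binomial_symmetric[symmetric])
      moreover have "v - P = k - ?l' 1" and "k choose (k - ?l' 1) = k choose ?l' 1"
        using l'1 by (auto simp: v_def binomial_symmetric[symmetric])
      ultimately show ?thesis
        unfolding K_val_def P_def[symmetric] by (simp add: ac_simps)
    qed
    also have "(\<Sum>d\<le>?l t. of_nat (?F (v + d) * (?l t choose d)) * a t ^ d) =
        (\<Sum>e\<le>?l t. of_nat (?F (v + (?l t - e)) * (?l t choose e)) * a t ^ (?l t - e))"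
      by (rule sum.reindex_bij_witness[of _ "\<lambda>e. ?l t - e" "\<lambda>e. ?l t - e"])
         (auto simp: binomial_symmetric[symmetric])
    also have "\<dots> = (\<Sum>e\<le>k. of_nat (?F (v + (?l t - e)) * (?l t choose e)) * a t ^ (?l t - e))"
      using lt by (intro sum.mono_neutral_left) (auto simp: binomial_eq_0)
    finally show ?thesis
      unfolding transfer_def split sum_distrib_right 
      by (simp only: of_nat_mult mult.assoc mult.commute mult.left_commute)
  next
    case False
    have "K t k a \<alpha> \<beta> = 0"
    proof (rule K_entry_zero, rule notI)
      \<comment> \<open>Data producing \<open>\<beta>\<close> would have to agree with
        \<open>p\<close> on {1..<t} and satisfy w = v, forcing the excluded case.\<close>
      fix q w assume data: "(q, w) \<in> K_data t k ?l" and \<beta>_eq: "\<beta> = K_col t k ?l q w"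
      then have q: "q \<in> (\<Pi>\<^sub>E i\<in>{1..<t}. {0..?l i})" and w: "(\<Sum>i=1..<t. q i) \<le> w" "w \<le> k"
        by (auto simp: K_data_def)
      have l': "?l' i = (if i = 1 then k - w + (\<Sum>j=1..<t. q j) else ?l (i - 1) - q (i - 1))"
        if "i \<in> {1..t}" for i
        using count_list_rep_word[OF that] unfolding \<beta>_eq K_col_def by simp
      have "?l' (Suc i) = ?l i - q i" if "i \<in> {1..<t}" for i
        using l'[of "Suc i"] that by auto
      then have le: "?l' (Suc i) \<le> ?l i" and "p i = q i" if "i \<in> {1..<t}" for i
        using PiE_mem[OF q] that by (auto simp: p_def)
      then have "P = (\<Sum>i=1..<t. q i)"
        unfolding P_def by (intro sum.cong) auto
      then have "v \<le> k"
        using l'[of 1] t w by (auto simp: v_def)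
      with le False show False by blast
    qed
    \<comment> \<open>Either some middle binomial vanishes, or all arguments of \<open>?F\<close>
      are at least v > k, where \<open>?F\<close> is 0.\<close>
    moreover have "(\<Prod>i=1..<t. ?l i choose ?l' (Suc i)) = 0 \<or> v > k"
      using False by (auto simp: not_le)
    then have "transfer t k a ?F ?l ?l' = 0"
    proof
      assume "(\<Prod>i=1..<t. ?l i choose ?l' (Suc i)) = 0"
      then show ?thesis
        unfolding transfer_def split
        by (simp only: mult_zero_left mult_zero_right of_nat_0 sum.neutral_const)
    next
      assume "v > k"
      then show ?thesis
        unfolding transfer_def split by (simp add: binomial_eq_0)
    qed
    ultimately show ?thesis by simp
  qed
qed

subsection \<open>The lowering matrices\<close>

text \<open>Differentiation by x_j sends the row monomial to a multiple of the column monomial.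
  Raising the column instead of lowering the row avoids truncated subtraction.\<close>

definition lower :: "nat \<Rightarrow> nat \<Rightarrow> nat list \<Rightarrow> nat list \<Rightarrow> 'a::comm_ring_1" where
  "lower t j \<alpha> \<beta> =
     (if \<alpha> = rep_word t ((count_list \<beta>)(j := Suc (count_list \<beta> j)))
      then of_nat (Suc (count_list \<beta> j)) else 0)"

text \<open>Only the raised word can contribute, and it leaves \<open>G t k\<close> when the
  multiplicity of j is already k.\<close>

lemma mat_times_lower_right:
  assumes "\<beta> \<in> G t k" "j \<in> {1..t}"
  shows "mat_times (G t k) A (lower t j) \<alpha> \<beta> =
     of_nat (Suc (count_list \<beta> j)) *
       (if count_list \<beta> j < k
        then A \<alpha> (rep_word t ((count_list \<beta>)(j := Suc (count_list \<beta> j)))) else 0)"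
proof -
  let ?w = "rep_word t ((count_list \<beta>)(j := Suc (count_list \<beta> j)))"
  have "?w \<in> G t k \<longleftrightarrow> count_list \<beta> j < k"
    using assms count_list_le[OF assms(1)] by (auto simp: rep_word_in_G_iff)
  moreover have "mat_times (G t k) A (lower t j) \<alpha> \<beta> =
      (\<Sum>z\<in>G t k. if z = ?w then A \<alpha> ?w * of_nat (Suc (count_list \<beta> j)) else 0)"
    unfolding mat_times_def lower_def by (intro sum.cong) auto
  ultimately show ?thesis
    using finite_G[of t k] by (simp add: mult.commute)
qed

lemma mat_times_lower_left:
  assumes \<alpha>: "\<alpha> \<in> G t k" and j: "j \<in> {1..t}"
  shows "mat_times (G t k) (lower t j) A \<alpha> \<beta> =
     of_nat (count_list \<alpha> j) * A (rep_word t ((count_list \<alpha>)(j := count_list \<alpha> j - 1))) \<beta>"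
proof -
  let ?l = "count_list \<alpha>"
  let ?w = "rep_word t (?l(j := ?l j - 1))"
  have w: "?w \<in> G t k"
    using \<alpha> by (rule rep_word_decrement_in_G)
  have "lower t j \<alpha> z = (if z = ?w then of_nat (?l j) else (0::'a))" if z: "z \<in> G t k" for z
  proof -
    let ?q = "count_list z"
    have up: "\<alpha> = rep_word t (?q(j := Suc (?q j))) \<longleftrightarrow>
        (\<forall>i\<in>{1..t}. ?l i = (?q(j := Suc (?q j))) i)"
      using rep_word_eq_iff[of t ?l] unfolding rep_word_count_list[OF \<alpha>] .
    have down: "z = ?w \<longleftrightarrow> (\<forall>i\<in>{1..t}. ?q i = (?l(j := ?l j - 1)) i)"
      using rep_word_eq_iff[of t ?q] unfolding rep_word_count_list[OF z] .
    show ?thesis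
    \<comment> \<open>If \<open>?l j = 0\<close>, the truncated decrement makes \<open>?w\<close>
      equal to \<open>\<alpha>\<close>; the entry there is 0, as is
      \<open>of_nat (?l j)\<close>.\<close>
    proof (cases "z = ?w \<and> ?l j \<noteq> 0")
      case True
      then have "?q i = (?l(j := ?l j - 1)) i" if "i \<in> {1..t}" for i
        using down that by blast
      then have "?l i = (?q(j := Suc (?q j))) i" if "i \<in> {1..t}" for i
        using True j that by auto
      then have \<alpha>_eq: "\<alpha> = rep_word t (?q(j := Suc (?q j)))" and lj: "?l j = Suc (?q j)"
        using up j by auto
      show ?thesis
        unfolding lower_def if_P[OF \<alpha>_eq] if_P[OF conjunct1[OF True]] by (simp only: lj)
    next
      case False
      have "\<alpha> \<noteq> rep_word t (?q(j := Suc (?q j)))"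
      proof
        assume "\<alpha> = rep_word t (?q(j := Suc (?q j)))"
        then have l: "?l i = (?q(j := Suc (?q j))) i" if "i \<in> {1..t}" for i
          using up that by blast
        then have "?q i = (?l(j := ?l j - 1)) i" if "i \<in> {1..t}" for i
          using l[OF j] l[OF that] by auto
        then show False
          using False down l[OF j] by simp
      qed
      then show ?thesis
        unfolding lower_def using False by (auto simp only: if_False if_True of_nat_0 split: if_split)
    qed
  qed
  then have "mat_times (G t k) (lower t j) A \<alpha> \<beta> =
      (\<Sum>z\<in>G t k. if z = ?w then of_nat (?l j) * A ?w \<beta> else 0)"
    unfolding mat_times_def by (intro sum.cong) auto
  then show ?thesis
    using w finite_G[of t k] by simp
qed

subsection \<open>Traces\<close>

lemma mat_times_cong:
  assumes "\<And>z. z \<in> S \<Longrightarrow> A x z = A' x z" "\<And>z. z \<in> S \<Longrightarrow> B z y = B' z y"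
  shows "mat_times S A B x y = mat_times S A' B' x y"
  unfolding mat_times_def using assms by (intro sum.cong) auto

lemma mat_times_assoc: "mat_times S (mat_times S A B) C = mat_times S A (mat_times S B C)"
  unfolding mat_times_def sum_distrib_left sum_distrib_right mult.assoc
  by (intro ext sum.swap)

lemma mat_times_id_left: "finite S \<Longrightarrow> x \<in> S \<Longrightarrow> mat_times S mat_id A x y = A x y"
  unfolding mat_times_def mat_id_def
  by (simp add: if_distrib[of "\<lambda>u. u * _"] cong: if_cong)

lemma mat_times_id_right: "finite S \<Longrightarrow> y \<in> S \<Longrightarrow> mat_times S A mat_id x y = A x y"
  unfolding mat_times_def mat_id_def by (simp add: if_distrib cong: if_cong)

lemma mat_trace_commute: "mat_trace S (mat_times S A B) = mat_trace S (mat_times S B A)"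
  unfolding mat_trace_def mat_times_def by (subst sum.swap) (simp add: mult.commute)

lemma mat_trace_cong: "(\<And>x. x \<in> S \<Longrightarrow> A x x = B x x) \<Longrightarrow> mat_trace S A = mat_trace S B"
  unfolding mat_trace_def by simp

section \<open>Relations between K, its derivatives and the lowering matrices\<close>

context
  fixes t k :: nat
  assumes t: "t \<ge> 1"
begin

definition K' :: "nat list \<Rightarrow> nat list \<Rightarrow> int_mpoly" where
  "K' \<alpha> \<beta> = transfer t k Var (\<lambda>s. fact (Suc s) * (k choose Suc s)) (count_list \<alpha>) (count_list \<beta>)"

lemma transfer_rep_word_left:
  "transfer t k a F (count_list (rep_word t l)) l' = transfer t k a F l l'"
  using t by (intro transfer_cong) (simp_all add: count_list_rep_word)

lemma transfer_rep_word_right: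
  "transfer t k a F l (count_list (rep_word t l')) = transfer t k a F l l'"
  using t by (intro transfer_cong) (simp_all add: count_list_rep_word)

lemma lower_K:
  assumes \<alpha>: "\<alpha> \<in> G t k" and \<beta>: "\<beta> \<in> G t k" and j: "1 \<le> j" "j < t"
  shows "mat_times (G t k) (lower t j) (K t k a) \<alpha> \<beta> =
         mat_times (G t k) (K t k a) (lower t (Suc j)) \<alpha> \<beta>"
proof -
  let ?l = "count_list \<alpha>" and ?l' = "count_list \<beta>"
  let ?F = "\<lambda>s. fact s * (k choose s) :: nat"
  have "rep_word t (?l(j := ?l j - 1)) \<in> G t k"
    using \<alpha> by (rule rep_word_decrement_in_G)
  then have left: "mat_times (G t k) (lower t j) (K t k a) \<alpha> \<beta> =
      of_nat (?l j) * transfer t k a ?F (?l(j := ?l j - 1)) ?l'"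
    using j t \<alpha> \<beta> by (simp add: mat_times_lower_left K_eq_transfer transfer_rep_word_left)
  have "mat_times (G t k) (K t k a) (lower t (Suc j)) \<alpha> \<beta> =
      of_nat (Suc (?l' (Suc j))) * transfer t k a ?F ?l (?l'(Suc j := Suc (?l' (Suc j))))"
  proof (cases "?l' (Suc j) < k")
    case True
    then have "rep_word t (?l'(Suc j := Suc (?l' (Suc j)))) \<in> G t k"
      using count_list_le[OF \<beta>] by (auto simp: rep_word_in_G_iff)
    then show ?thesis
      using True j t \<alpha> \<beta>
      by (simp add: mat_times_lower_right K_eq_transfer transfer_rep_word_right)
  next
    case False
    \<comment> \<open>Here the raised column has multiplicity k + 1 at j + 1, exceeding the row
      multiplicity of j, which is at most k.\<close>
    then have "transfer t k a ?F ?l (?l'(Suc j := Suc (?l' (Suc j)))) = 0"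
      using count_list_le[OF \<alpha>, of j] j by (intro transfer_eq_0[of j]) auto
    then show ?thesis
      using False j \<beta> by (simp add: mat_times_lower_right)
  qed
  then show ?thesis
    using left transfer_absorb[OF j] by metis
qed

lemma mat_deriv_0_K:
  assumes \<alpha>: "\<alpha> \<in> G t k" and \<beta>: "\<beta> \<in> G t k"
  shows "mat_deriv 0 (K t k Var) \<alpha> \<beta> = mat_times (G t k) K' (lower t 1) \<alpha> \<beta>"
proof (cases "count_list \<beta> 1 < k")
  case True
  then show ?thesis
    using t \<alpha> \<beta>
    by (simp add: mat_deriv_def K_eq_transfer partial_deriv_0_transfer mat_times_lower_right K'_def
        transfer_rep_word_right)
next
  case False
  then have "transfer t k Var F (count_list \<alpha>) ((count_list \<beta>)(1 := Suc (count_list \<beta> 1))) = 0" for F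
    using t by (intro transfer_eq_0[of 0]) auto
  then show ?thesis
    using False t \<alpha> \<beta>
    by (simp add: mat_deriv_def K_eq_transfer partial_deriv_0_transfer mat_times_lower_right)
qed

lemma mat_deriv_K:
  assumes \<alpha>: "\<alpha> \<in> G t k" and \<beta>: "\<beta> \<in> G t k" and n: "n \<in> {1..t}"
  shows "mat_deriv n (K t k Var) \<alpha> \<beta> = mat_times (G t k) (lower t n) K' \<alpha> \<beta>"
  using t n \<alpha> \<beta>
  by (simp add: mat_deriv_def K_eq_transfer partial_deriv_transfer mat_times_lower_left K'_def
      transfer_rep_word_left)

text \<open>Each factor K passed raises the lowering index by one, so the induction needs arbitrary
  j. The bound \<open>j + m \<le> t\<close> keeps every index to which \<open>lower_K\<close> is
  applied below t.\<close>

lemma lower_power_K: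
  assumes "\<alpha> \<in> G t k" "\<beta> \<in> G t k" "1 \<le> j" "j + m \<le> t"
  shows "mat_times (G t k) (lower t j) (mat_power (G t k) (K t k a) m) \<alpha> \<beta> =
         mat_times (G t k) (mat_power (G t k) (K t k a) m) (lower t (j + m)) \<alpha> \<beta>"
  using assms
proof (induction m arbitrary: j \<alpha>)
  case 0
  then show ?case
    by (simp add: mat_times_id_left mat_times_id_right finite_G)
next
  case (Suc m)
  let ?S = "G t k" and ?K = "K t k a"
  let ?P = "mat_power ?S ?K m"
  have "mat_times ?S (mat_times ?S (lower t j) ?K) ?P \<alpha> \<beta> =
      mat_times ?S (mat_times ?S ?K (lower t (Suc j))) ?P \<alpha> \<beta>"
    using Suc.prems by (intro mat_times_cong refl lower_K) auto
  moreover have "mat_times ?S ?K (mat_times ?S (lower t (Suc j)) ?P) \<alpha> \<beta> =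
      mat_times ?S ?K (mat_times ?S ?P (lower t (j + Suc m))) \<alpha> \<beta>"
    using Suc.prems Suc.IH[of _ "Suc j"] by (intro mat_times_cong[of ?S ?K] refl) auto
  ultimately show ?case
    by (simp add: mat_times_assoc)
qed

end

theorem theorem10:
  fixes k t n :: nat
  assumes "k \<ge> 1" and "t \<ge> 1" and "1 \<le> n" and "n \<le> t"
  shows "mat_trace (G t k) (mat_times (G t k) (mat_deriv 0 (K t k Var)) (mat_power (G t k) (K t k Var) (n - 1)))
       = mat_trace (G t k) (mat_times (G t k) (mat_deriv n (K t k Var)) (mat_power (G t k) (K t k Var) (n - 1)))"
proof -
  let ?S = "G t k" and ?P = "mat_power (G t k) (K t k Var) (n - 1)" and ?K' = "K' t k"
  have "mat_trace ?S (mat_times ?S (mat_deriv 0 (K t k Var)) ?P) =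
      mat_trace ?S (mat_times ?S (mat_times ?S ?K' (lower t 1)) ?P)"
    using assms by (intro mat_trace_cong mat_times_cong refl mat_deriv_0_K) auto
  also have "\<dots> = mat_trace ?S (mat_times ?S ?K' (mat_times ?S (lower t 1) ?P))"
    by (simp only: mat_times_assoc)
  also have "\<dots> = mat_trace ?S (mat_times ?S ?K' (mat_times ?S ?P (lower t n)))"
    \<comment> \<open>Starting from index 1, passing n - 1 factors ends at index n.\<close>
    using assms lower_power_K[of t _ k _ 1 "n - 1" Var]
    by (intro mat_trace_cong mat_times_cong[of ?S ?K'] refl) auto
  also have "\<dots> = mat_trace ?S (mat_times ?S (mat_times ?S (lower t n) ?K') ?P)"
    unfolding mat_times_assoc[symmetric] by (subst mat_trace_commute) (simp only: mat_times_assoc)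
  also have "\<dots> = mat_trace ?S (mat_times ?S (mat_deriv n (K t k Var)) ?P)"
    using assms by (intro mat_trace_cong mat_times_cong refl mat_deriv_K[symmetric]) auto
  finally show ?thesis .
qed

end
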